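(* Let $n,r,t$ be integers with $r\ge 1$, $t\ge 1$ and $n \geq 2r+2t+2$. Then there is a graph $G$ on $n$ vertices (namely the complete graph $K_n$) such that the integrality gap of the level-$r$ Sherali–Adams tightening $\mathcal S^{(r)}(P_t(G))$ of the $t$-partial-vertex-cover LP relaxation is at least $\binom{n-2r}{2}/(t\cdot n)$; i.e. the minimum number of vertices of a $t$-partial vertex cover of $G$ divided by $\min\{\sum_{i\in V} x_i : x\in \mathcal S^{(r)}(P_t(G))\}$ is at least $\binom{n-2r}{2}/(t\cdot n)$.
   Context: For a graph $G=(V,E)$ and an integer $t\le |E|$, a $t$-partial vertex cover is a set $S\subseteq V$ such that at least $t$ edges have an endpoint in $S$; the unweighted $t$-Partial-Vertex-Cover problem asks for one of minimum size. Its LP relaxation has variables $x_q$, $q\in V\cup E$, objective $\min \sum_{i\in V} x_i$, and constraints: $x_i+x_j\ge x_e$ for every edge $e=\{i,j\}\in E$; $\sum_{e\in E} x_e\ge t$; $0\le x_q\le 1$ for all $q\in V\cup E$. Its feasible region is denoted $P_t(G)\subseteq[0,1]^m$ with ground set $[m]=V\cup E$. The integrality gap of a relaxation is the ratio of the optimal integral cost to the optimal value of the relaxation. Sherali–Adams system: let $P\subseteq[0,1]^m$ be given by linear constraints $a^Tx\ge b$. Its homogenization is the cone $K\subseteq\mathbb R^{\{\emptyset\}\cup[m]}$ of vectors $\bar x$ with $\bar x_\emptyset\ge 0$ and $a^T\bar x\ge b\,\bar x_\emptyset$ for each constraint (where $\bar x_{\{p\}}$ replaces $x_p$). Let $\mathcal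 P_r$ be the family of subsets of $[m]$ of size at most $r$. For $y\in\mathbb R^{\mathcal P_{r+1}}$, its moment matrix $\mathcal Y$ has rows indexed by $\mathcal P_1$, columns indexed by $\mathcal P_r$, and $\mathcal Y_{A,B}=y_{A\cup B}$; $\mathbf e_I$ denotes standard basis vectors. The level-$r$ Sherali–Adams cone $M^{(r)}$ is the set of $x\in\mathbb R^{\mathcal P_1}$ for which there is $y\in\mathbb R^{\mathcal P_{r+1}}$ with $\mathcal Y\mathbf e_\emptyset=x$ and, for all $Y,N\subseteq[m]$ with $Y\cup N\in\mathcal P_r$, $\mathcal Y\sum_{T\subseteq N}(-1)^{|T|}\mathbf e_{Y\cup T}\in K$. The level-$r$ tightening is $\mathcal S^{(r)}(P)=M^{(r)}\cap\{x_\emptyset=1\}$, viewed as a subset of $[0,1]^m$. *)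

theory Defs
  imports Complex_Main "HOL-Library.FuncSet"
begin

record 'v ugraph =
  verts :: "'v set"
  edges :: "'v set set"

definition simple_graph :: "'v ugraph \<Rightarrow> bool" where
  "simple_graph G \<longleftrightarrow> finite (verts G) \<and> edges G \<subseteq> {e. e \<subseteq> verts G \<and> card e = 2}"

definition complete_graph :: "'v ugraph \<Rightarrow> bool" where
  "complete_graph G \<longleftrightarrow> simple_graph G \<and> edges G = {e. e \<subseteq> verts G \<and> card e = 2}"

definition partial_vertex_cover :: "'v ugraph \<Rightarrow> nat \<Rightarrow> 'v set \<Rightarrow> bool" where
  "partial_vertex_cover G t S \<longleftrightarrow> S \<subseteq> verts G \<and> t \<le> card {e \<in> edges G. e \<inter> S \<noteq> {}}"

definition min_partial_vertex_cover :: "'v ugraph \<Rightarrow> nat \<Rightarrow> nat" where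
  "min_partial_vertex_cover G t = (LEAST k. \<exists>S. partial_vertex_cover G t S \<and> card S = k)"


text \<open>
  A pair \<open>(a, b)\<close> stands for the inequality \<open>(\<Sum>p\<in>I. a p * x p) \<ge> b\<close> over a finite ground
  set \<open>I\<close>. Vectors over an index set are extensional functions on it.
\<close>

type_synonym 'i linear_constraint = "('i \<Rightarrow> real) \<times> real"

definition polyhedron_of :: "'i set \<Rightarrow> 'i linear_constraint set \<Rightarrow> ('i \<Rightarrow> real) set" where
  "polyhedron_of I C = {x \<in> I \<rightarrow>\<^sub>E UNIV. \<forall>(a, b)\<in>C. (\<Sum>p\<in>I. a p * x p) \<ge> b}"

definition subsets_upto :: "'i set \<Rightarrow> nat \<Rightarrow> 'i set set" where
  "subsets_upto I r = {A. A \<subseteq> I \<and> card A \<le> r}"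

definition homogenization :: "'i set \<Rightarrow> 'i linear_constraint set \<Rightarrow> ('i set \<Rightarrow> real) set" where
  "homogenization I C = {x \<in> subsets_upto I 1 \<rightarrow>\<^sub>E UNIV. x {} \<ge> 0 \<and>
     (\<forall>(a, b)\<in>C. (\<Sum>p\<in>I. a p * x {p}) \<ge> b * x {})}"

definition moment_column :: "'i set \<Rightarrow> ('i set \<Rightarrow> real) \<Rightarrow> 'i set \<Rightarrow> ('i set \<Rightarrow> real)" where
  "moment_column I y B = (\<lambda>A\<in>subsets_upto I 1. y (A \<union> B))"

definition sherali_adams_cone ::
    "'i set \<Rightarrow> 'i linear_constraint set \<Rightarrow> nat \<Rightarrow> ('i set \<Rightarrow> real) set" where
  "sherali_adams_cone I C r = {x \<in> subsets_upto I 1 \<rightarrow>\<^sub>E UNIV.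
     \<exists>y \<in> subsets_upto I (r + 1) \<rightarrow>\<^sub>E UNIV. moment_column I y {} = x \<and>
       (\<forall>Y N. Y \<subseteq> I \<and> N \<subseteq> I \<and> Y \<union> N \<in> subsets_upto I r \<longrightarrow>
          (\<lambda>A\<in>subsets_upto I 1. \<Sum>T\<in>Pow N. (-1) ^ card T * moment_column I y (Y \<union> T) A)
            \<in> homogenization I C)}"

definition sherali_adams ::
    "'i set \<Rightarrow> 'i linear_constraint set \<Rightarrow> nat \<Rightarrow> ('i \<Rightarrow> real) set" where
  "sherali_adams I C r = (\<lambda>z. \<lambda>p\<in>I. z {p}) ` {z \<in> sherali_adams_cone I C r. z {} = 1}"


text \<open>The ground set is the disjoint sum of \<open>verts G\<close> (via \<open>Inl\<close>) and \<open>edges G\<close> (via \<open>Inr\<close>).\<close>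

definition pvc_ground :: "'v ugraph \<Rightarrow> ('v + 'v set) set" where
  "pvc_ground G = verts G <+> edges G"

definition pvc_constraints :: "'v ugraph \<Rightarrow> nat \<Rightarrow> ('v + 'v set) linear_constraint set" where
  "pvc_constraints G t =
     {(case_sum (\<lambda>v. of_bool (v \<in> e)) (\<lambda>f. - of_bool (f = e)), 0) | e. e \<in> edges G} \<union>
     {(case_sum (\<lambda>_. 0) (\<lambda>_. 1), real t)} \<union>
     {(\<lambda>p. of_bool (p = q), 0) | q. q \<in> pvc_ground G} \<union>
     {(\<lambda>p. - of_bool (p = q), -1) | q. q \<in> pvc_ground G}"

definition pvc_polytope :: "'v ugraph \<Rightarrow> nat \<Rightarrow> ('v + 'v set \<Rightarrow> real) set" where
  "pvc_polytope G t = polyhedron_of (pvc_ground G) (pvc_constraints G t)"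

definition pvc_sherali_adams :: "'v ugraph \<Rightarrow> nat \<Rightarrow> nat \<Rightarrow> ('v + 'v set \<Rightarrow> real) set" where
  "pvc_sherali_adams G t r = sherali_adams (pvc_ground G) (pvc_constraints G t) r"

definition fractional_cost :: "'v ugraph \<Rightarrow> ('v + 'v set \<Rightarrow> real) \<Rightarrow> real" where
  "fractional_cost G x = (\<Sum>i\<in>verts G. x (Inl i))"

text \<open>The infimum is the optimal value of the relaxation \<open>R\<close> when \<open>R\<close> has a minimiser.\<close>

definition integrality_gap :: "'v ugraph \<Rightarrow> nat \<Rightarrow> ('v + 'v set \<Rightarrow> real) set \<Rightarrow> real" where
  "integrality_gap G t R =
     real (min_partial_vertex_cover G t) / (INF x\<in>R. fractional_cost G x)"


text \<open>The encoded constraints are the usual inequalities of the relaxation.\<close>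

lemma simple_graph_finite:
  assumes "simple_graph G"
  shows "finite (verts G)" "finite (edges G)"
proof -
  show "finite (verts G)"
    using assms by (simp add: simple_graph_def)
  then have "finite (Pow (verts G))"
    by simp
  moreover have "edges G \<subseteq> Pow (verts G)"
    using assms by (auto simp: simple_graph_def)
  ultimately show "finite (edges G)"
    by (rule finite_subset[rotated])
qed

lemma pvc_polytope_iff:
  assumes G: "simple_graph G"
  shows "x \<in> pvc_polytope G t \<longleftrightarrow>
    x \<in> pvc_ground G \<rightarrow>\<^sub>E {0..1} \<and>
    (\<forall>i j. {i, j} \<in> edges G \<longrightarrow> x (Inl i) + x (Inl j) \<ge> x (Inr {i, j})) \<and>
    (\<Sum>e\<in>edges G. x (Inr e)) \<ge> real t"
proof -
  note fin = simple_graph_finite[OF G]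
  have finI: "finite (pvc_ground G)"
    using fin by (simp add: pvc_ground_def)
  have unit: "(\<Sum>p\<in>pvc_ground G. of_bool (p = q) * x p) = x q" if "q \<in> pvc_ground G" for q
    using that finI by (simp add: of_bool_def if_distrib[of "\<lambda>c. c * _"] sum.delta cong: if_cong)
  have split: "(\<Sum>p\<in>pvc_ground G. case_sum a b p * x p) =
      (\<Sum>v\<in>verts G. a v * x (Inl v)) + (\<Sum>e\<in>edges G. b e * x (Inr e))" for a b
    using fin by (simp add: pvc_ground_def sum.Plus)
  have edge: "(\<Sum>p\<in>pvc_ground G.
        case_sum (\<lambda>v. of_bool (v \<in> e)) (\<lambda>f. - of_bool (f = e)) p * x p) =
      (\<Sum>v\<in>e. x (Inl v)) - x (Inr e)" if e: "e \<in> edges G" for e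
  proof -
    have "e \<subseteq> verts G"
      using G e by (auto simp: simple_graph_def)
    then have "(\<Sum>v\<in>verts G. of_bool (v \<in> e) * x (Inl v)) = (\<Sum>v\<in>e. x (Inl v))"
      using fin by (intro sum.mono_neutral_cong_right) auto
    moreover have "(\<Sum>f\<in>edges G. - of_bool (f = e) * x (Inr f)) = - x (Inr e)"
      using e fin
      by (simp add: of_bool_def if_distrib[of "\<lambda>c. c * _"] sum.delta sum_negf cong: if_cong)
    ultimately show ?thesis
      by (simp only: split)
  qed
  have edges_iff: "(\<forall>e\<in>edges G. (\<Sum>v\<in>e. x (Inl v)) \<ge> x (Inr e)) \<longleftrightarrow>
      (\<forall>i j. {i, j} \<in> edges G \<longrightarrow> x (Inl i) + x (Inl j) \<ge> x (Inr {i, j}))"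
  proof -
    have two: "(\<Sum>v\<in>{i, j}. x (Inl v)) = x (Inl i) + x (Inl j)" if "{i, j} \<in> edges G" for i j
    proof -
      have "card {i, j} = 2"
        using G that by (auto simp: simple_graph_def)
      then have "i \<noteq> j"
        by auto
      then show ?thesis
        by simp
    qed
    have "\<exists>i j. e = {i, j}" if "e \<in> edges G" for e
      using G that unfolding simple_graph_def card_2_iff by blast
    then show ?thesis
      using two by metis
  qed
  have "x \<in> pvc_polytope G t \<longleftrightarrow> x \<in> pvc_ground G \<rightarrow>\<^sub>E UNIV \<and>
      (\<forall>e\<in>edges G. (\<Sum>v\<in>e. x (Inl v)) - x (Inr e) \<ge> 0) \<and>
      (\<Sum>e\<in>edges G. x (Inr e)) \<ge> real t \<and>
      (\<forall>q\<in>pvc_ground G. x q \<ge> 0) \<and> (\<forall>q\<in>pvc_ground G. - x q \<ge> -1)"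
    unfolding pvc_polytope_def polyhedron_of_def pvc_constraints_def
    using edge unit split[of "\<lambda>_. 0" "\<lambda>_. 1"]
    by (simp add: ball_Un sum_negf Ball_def imp_ex all_conj_distrib) blast
  then show ?thesis
    unfolding edges_iff[symmetric] by (auto simp: PiE_iff)
qed

end

theory Submission
  imports Defs "HOL-Analysis.Function_Topology"
begin

text \<open>
  Put weight \<open>\<epsilon>\<close> on each of the \<open>n\<close> integral points "take the single vertex \<open>v\<close> and all edges
  at \<open>v\<close>", and the remaining weight \<open>1 - n \<epsilon>\<close> on the zero vector. The zero vector violates only the
  covering constraint, and it survives conditioning on \<open>(Y, N)\<close> only if \<open>Y = {}\<close>. Then the at most
  \<open>r\<close> elements of \<open>N\<close> touch at most \<open>2 r\<close> vertices, so the other stars still provide edge weight at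
  least \<open>\<epsilon> (n - 2 r) (n - 1)\<close>, which is at least \<open>t\<close> for \<open>\<epsilon> = t / ((n - 2 r) choose 2)\<close>. If this
  value of \<open>\<epsilon>\<close> exceeds \<open>1 / n\<close>, the claimed gap is below 1 and \<open>\<epsilon> = 1 / n\<close> suffices.
\<close>

section \<open>Lifted vectors of the Sherali-Adams system\<close>

text \<open>If \<open>y A\<close> is the probability that a random set \<open>S\<close> contains
  \<open>A\<close>, then by inclusion-exclusion this is the probability that \<open>S\<close>
  contains \<open>A\<close> and \<open>Y\<close> and avoids \<open>N\<close>. For general
  \<open>y\<close> it is a formal analogue.\<close>

definition conditioned :: "('i set \<Rightarrow> real) \<Rightarrow> 'i set \<Rightarrow> 'i set \<Rightarrow> 'i set \<Rightarrow> real" where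
  "conditioned y Y N A = (\<Sum>T\<in>Pow N. (-1) ^ card T * y (A \<union> (Y \<union> T)))"

text \<open>Works with the witnesses \<open>y\<close> instead of their projections: conditions on
  \<open>y\<close> alone are closed, which suits compactness, and a distribution yields such a
  \<open>y\<close> directly.\<close>

definition sa_lifts :: "'i set \<Rightarrow> 'i linear_constraint set \<Rightarrow> nat \<Rightarrow> ('i set \<Rightarrow> real) set" where
  "sa_lifts I C r = {y \<in> subsets_upto I (r + 1) \<rightarrow>\<^sub>E UNIV. y {} = 1 \<and>
     (\<forall>Y N. Y \<union> N \<in> subsets_upto I r \<longrightarrow> 0 \<le> conditioned y Y N {} \<and>
       (\<forall>a b. (a, b) \<in> C \<longrightarrow> b * conditioned y Y N {} \<le> (\<Sum>p\<in>I. a p * conditioned y Y N {p})))}"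

lemma sa_liftsD:
  assumes "y \<in> sa_lifts I C r"
  shows "y {} = 1"
    and "Y \<union> N \<in> subsets_upto I r \<Longrightarrow> (a, b) \<in> C \<Longrightarrow>
      b * conditioned y Y N {} \<le> (\<Sum>p\<in>I. a p * conditioned y Y N {p})"
  using assms unfolding sa_lifts_def by blast+

lemma empty_in_subsets_upto [simp]: "{} \<in> subsets_upto I r"
  by (simp add: subsets_upto_def)

lemma singleton_in_subsets_upto [simp]: "{p} \<in> subsets_upto I (Suc r) \<longleftrightarrow> p \<in> I"
  by (simp add: subsets_upto_def)

text \<open>The homogenization looks only at entries indexed by the empty set and by singletons, and
  there the signed sum of moment columns agrees with \<open>conditioned\<close>.\<close>

lemma sherali_adams_eq_image:
  "sherali_adams I C r = (\<lambda>y. \<lambda>p\<in>I. y {p}) ` sa_lifts I C r"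
proof -
  have col: "(\<lambda>A\<in>subsets_upto I 1. \<Sum>T\<in>Pow N. (-1) ^ card T * moment_column I y (Y \<union> T) A)
      \<in> homogenization I C \<longleftrightarrow>
    0 \<le> conditioned y Y N {} \<and>
       (\<forall>a b. (a, b) \<in> C \<longrightarrow> b * conditioned y Y N {} \<le> (\<Sum>p\<in>I. a p * conditioned y Y N {p}))"
    (is "?v \<in> _ \<longleftrightarrow> ?R") for y Y N
  proof -
    have e: "?v {} = conditioned y Y N {}"
      by (simp add: moment_column_def conditioned_def)
    have s: "?v {p} = conditioned y Y N {p}" if "p \<in> I" for p
      using that by (simp add: moment_column_def conditioned_def)
    have sm: "(\<Sum>p\<in>I. a p * ?v {p}) = (\<Sum>p\<in>I. a p * conditioned y Y N {p})" for a
      by (intro sum.cong refl) (simp only: s)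
    show ?thesis
      unfolding homogenization_def mem_Collect_eq e sm by auto
  qed
  have "{z \<in> sherali_adams_cone I C r. z {} = 1} = (\<lambda>y. moment_column I y {}) ` sa_lifts I C r"
  proof -
    have pre: "Y \<subseteq> I \<and> N \<subseteq> I \<and> Y \<union> N \<in> subsets_upto I r \<longleftrightarrow> Y \<union> N \<in> subsets_upto I r" for Y N
      by (auto simp: subsets_upto_def)
    have one: "moment_column I y {} {} = y {}" for y
      by (simp add: moment_column_def)
    have ext: "moment_column I y {} \<in> subsets_upto I 1 \<rightarrow>\<^sub>E UNIV" for y
      by (simp add: moment_column_def)
    define Q where "Q y \<longleftrightarrow> (\<forall>Y N. Y \<union> N \<in> subsets_upto I r \<longrightarrow> 0 \<le> conditioned y Y N {} \<and>
      (\<forall>a b. (a, b) \<in> C \<longrightarrow> b * conditioned y Y N {} \<le> (\<Sum>p\<in>I. a p * conditioned y Y N {p})))"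
      for y
    have cone: "z \<in> sherali_adams_cone I C r \<longleftrightarrow> z \<in> subsets_upto I 1 \<rightarrow>\<^sub>E UNIV \<and>
        (\<exists>y\<in>subsets_upto I (r + 1) \<rightarrow>\<^sub>E UNIV. moment_column I y {} = z \<and> Q y)" for z
      unfolding sherali_adams_cone_def col pre Q_def mem_Collect_eq ..
    have lifts: "y \<in> sa_lifts I C r \<longleftrightarrow>
        y \<in> subsets_upto I (r + 1) \<rightarrow>\<^sub>E UNIV \<and> y {} = 1 \<and> Q y" for y
      unfolding sa_lifts_def Q_def mem_Collect_eq ..
    have "z \<in> sherali_adams_cone I C r \<and> z {} = 1 \<longleftrightarrow>
        (\<exists>y\<in>sa_lifts I C r. z = moment_column I y {})" for z
      unfolding cone Bex_def lifts using one ext by metis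
    then show ?thesis
      by (simp only: set_eq_iff mem_Collect_eq image_iff) simp
  qed
  then have "sherali_adams I C r = (\<lambda>z. \<lambda>p\<in>I. z {p}) ` (\<lambda>y. moment_column I y {}) ` sa_lifts I C r"
    by (simp only: sherali_adams_def)
  also have "\<dots> = (\<lambda>y. \<lambda>p\<in>I. y {p}) ` sa_lifts I C r"
    unfolding image_image by (intro image_cong refl restrict_ext) (simp add: moment_column_def)
  finally show ?thesis .
qed

lemma conditioned_empty [simp]: "conditioned y Y {} A = y (A \<union> Y)"
  by (simp add: conditioned_def)

text \<open>Conditioning on \<open>Y = N = {}\<close> returns \<open>y\<close> itself, and since
  \<open>y {} = 1\<close> the homogenized constraints become the original ones.\<close>

lemma sherali_adams_subset_polyhedron:
  assumes "x \<in> sherali_adams I C r"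
  shows "x \<in> polyhedron_of I C"
proof -
  obtain y where y: "y \<in> sa_lifts I C r" and x: "x = (\<lambda>p\<in>I. y {p})"
    using assms by (auto simp: sherali_adams_eq_image)
  have "b \<le> (\<Sum>p\<in>I. a p * y {p})" if "(a, b) \<in> C" for a b
    using sa_liftsD(1)[OF y] sa_liftsD(2)[OF y, of "{}" "{}" a b] that by simp
  then show ?thesis
    unfolding polyhedron_of_def x by auto
qed

section \<open>Boundedness and compactness\<close>

text \<open>Conditioning the bounds on coordinate \<open>q\<close> on \<open>Y = B\<close>,
  \<open>N = {}\<close> gives \<open>0 <= y (insert q B) <= y B\<close>. Induction from
  \<open>y {} = 1\<close> adds one element at a time; the last step has \<open>card B <= r\<close>,
  so it reaches sets of size \<open>r + 1\<close>.\<close>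

lemma sa_lifts_bounded:
  assumes I: "finite I" and y: "y \<in> sa_lifts I C r"
    and lower: "\<And>q. q \<in> I \<Longrightarrow> (\<lambda>p. of_bool (p = q), 0) \<in> C"
    and upper: "\<And>q. q \<in> I \<Longrightarrow> (\<lambda>p. - of_bool (p = q), -1) \<in> C"
    and A: "A \<in> subsets_upto I (r + 1)"
  shows "y A \<in> {0..1}"
proof -
  have step: "0 \<le> y (insert q B) \<and> y (insert q B) \<le> y B"
    if "B \<in> subsets_upto I r" and q: "q \<in> I" for q B
  proof -
    have C: "b * y B \<le> (\<Sum>p\<in>I. a p * y (insert p B))" if "(a, b) \<in> C" for a b
      using sa_liftsD(2)[OF y, of B "{}" a b] \<open>B \<in> subsets_upto I r\<close> that by simp
    show ?thesis
      using C[OF lower[OF q]] C[OF upper[OF q]] I q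
      by (simp add: of_bool_def if_distrib[of "\<lambda>c. c * _"] sum_negf cong: if_cong)
  qed
  have "finite A"
    using A I by (auto simp: subsets_upto_def intro: finite_subset)
  then show ?thesis
    using A
  proof (induction A)
    case empty
    then show ?case
      using y by (simp add: sa_lifts_def)
  next
    case (insert q B)
    then have "B \<in> subsets_upto I r" "B \<in> subsets_upto I (r + 1)" "q \<in> I"
      by (auto simp: subsets_upto_def)
    then show ?case
      using insert.IH step[of B q] by simp
  qed
qed

text \<open>The bounds on the entries place all lifts in a product of compact sets, and the
  remaining conditions are an equation and weak inequalities between continuous functions of
  \<open>y\<close>.\<close>

lemma compact_sa_lifts:
  assumes I: "finite I"
    and lower: "\<And>q. q \<in> I \<Longrightarrow> (\<lambda>p. of_bool (p = q), 0) \<in> C"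
    and upper: "\<And>q. q \<in> I \<Longrightarrow> (\<lambda>p. - of_bool (p = q), -1) \<in> C"
  shows "compact (sa_lifts I C r)"
proof -
  \<comment> \<open>Extensional functions equal \<open>undefined\<close> off the index set, so these
    coordinates get a singleton factor. This makes the box a compact set of total functions in the
    product topology.\<close>
  define box where
    "box = (\<Pi>\<^sub>E A\<in>UNIV. if A \<in> subsets_upto I (r + 1) then {0..1::real} else {undefined})"
  define F where "F = {y. y {} = 1 \<and>
     (\<forall>Y N. Y \<union> N \<in> subsets_upto I r \<longrightarrow> 0 \<le> conditioned y Y N {} \<and>
       (\<forall>a b. (a, b) \<in> C \<longrightarrow> b * conditioned y Y N {} \<le> (\<Sum>p\<in>I. a p * conditioned y Y N {p})))}"
  have "compact box"
    unfolding box_def compactin_euclidean_iff[symmetric] euclidean_product_topology[symmetric]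
      compactin_PiE by auto
  have cont: "continuous_on UNIV (\<lambda>y. conditioned y Y N A)" for Y N and A :: "'a set"
    unfolding conditioned_def by (intro continuous_intros continuous_on_product_coordinates)
  have "closed F"
    unfolding F_def
    by (intro closed_Collect_conj closed_Collect_all closed_Collect_imp open_Collect_const
      closed_Collect_eq closed_Collect_le continuous_intros cont continuous_on_product_coordinates)
  have "sa_lifts I C r = box \<inter> F"
  proof -
    have "y \<in> box" if "y \<in> sa_lifts I C r" for y
    proof -
      have "y A = undefined" if "A \<notin> subsets_upto I (r + 1)" for A
        using \<open>y \<in> sa_lifts I C r\<close> that by (auto simp: sa_lifts_def)
      then show ?thesis
        using sa_lifts_bounded[OF I that lower upper] by (auto simp: box_def PiE_iff)
    qed
    moreover have "y \<in> subsets_upto I (r + 1) \<rightarrow>\<^sub>E UNIV" if "y \<in> box" for y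
      using that by (auto simp: box_def PiE_iff extensional_def split: if_splits)
    ultimately show ?thesis
      by (auto simp: sa_lifts_def F_def)
  qed
  then show ?thesis
    using \<open>compact box\<close> \<open>closed F\<close> by (simp add: compact_Int_closed)
qed

lemma compact_sherali_adams:
  assumes "finite I"
    and "\<And>q. q \<in> I \<Longrightarrow> (\<lambda>p. of_bool (p = q), 0) \<in> C"
    and "\<And>q. q \<in> I \<Longrightarrow> (\<lambda>p. - of_bool (p = q), -1) \<in> C"
  shows "compact (sherali_adams I C r)"
  unfolding sherali_adams_eq_image
proof (rule compact_continuous_image[OF _ compact_sa_lifts[OF assms]])
  have "continuous_on (sa_lifts I C r) (\<lambda>y. (\<lambda>p\<in>I. y {p}) i)" for i
    by (cases "i \<in> I")
      (auto intro: continuous_on_product_coordinates[THEN continuous_on_subset])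
  then show "continuous_on (sa_lifts I C r) (\<lambda>y. \<lambda>p\<in>I. y {p})"
    by (rule continuous_on_coordinatewise_then_product)
qed

section \<open>Convex combinations of 0/1 points\<close>

text \<open>Adding \<open>x\<close> to \<open>N\<close> multiplies the sum by
  \<open>1 - of_bool (x \<in> S)\<close>, because each subset containing \<open>x\<close> carries
  the opposite sign of the one without it.\<close>

lemma sum_Pow_sign_subset:
  assumes "finite N"
  shows "(\<Sum>T\<in>Pow N. (-1) ^ card T * of_bool (T \<subseteq> S)) = (of_bool (N \<inter> S = {}) :: real)"
  using assms
proof (induction N)
  case (insert x N)
  have "(\<Sum>T\<in>Pow (insert x N). (-1) ^ card T * of_bool (T \<subseteq> S) :: real) =
      (\<Sum>T\<in>Pow N. (-1) ^ card T * of_bool (T \<subseteq> S)) +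
      (\<Sum>T\<in>insert x ` Pow N. (-1) ^ card T * of_bool (T \<subseteq> S))"
    unfolding Pow_insert using insert.hyps by (intro sum.union_disjoint) auto
  also have "(\<Sum>T\<in>insert x ` Pow N. (-1) ^ card T * of_bool (T \<subseteq> S) :: real) =
      (\<Sum>T\<in>Pow N. (-1) ^ card (insert x T) * of_bool (insert x T \<subseteq> S))"
    using insert.hyps by (subst sum.reindex) (auto simp: inj_on_def)
  also have "\<dots> = - of_bool (x \<in> S) * (\<Sum>T\<in>Pow N. (-1) ^ card T * of_bool (T \<subseteq> S))"
    unfolding sum_distrib_left
  proof (intro sum.cong refl)
    fix T
    assume "T \<in> Pow N"
    then have "x \<notin> T" "finite T"
      using insert.hyps by (auto intro: finite_subset)
    then show "(-1) ^ card (insert x T) * of_bool (insert x T \<subseteq> S) =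
        - of_bool (x \<in> S) * ((-1) ^ card T * of_bool (T \<subseteq> S) :: real)"
      by simp
  qed
  finally show ?case
    using insert.IH by auto
qed simp

text \<open>Conditioning the moments of a distribution on \<open>(Y, N)\<close> keeps exactly the
  points containing \<open>Y\<close> and avoiding \<open>N\<close>. A constraint need only hold on
  average over these survivors, so single points in the support may violate it.\<close>

lemma mixture_in_sherali_adams:
  fixes \<mu> :: "'w \<Rightarrow> real" and s :: "'w \<Rightarrow> 'i set"
  assumes I: "finite I" and nonneg: "\<And>\<omega>. \<omega> \<in> \<Omega> \<Longrightarrow> 0 \<le> \<mu> \<omega>"
    and total: "(\<Sum>\<omega>\<in>\<Omega>. \<mu> \<omega>) = 1"
    and valid: "\<And>Y N a b. Y \<union> N \<in> subsets_upto I r \<Longrightarrow> (a, b) \<in> C \<Longrightarrow>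
      0 \<le> (\<Sum>\<omega> | \<omega> \<in> \<Omega> \<and> Y \<subseteq> s \<omega> \<and> N \<inter> s \<omega> = {}. \<mu> \<omega> * ((\<Sum>p\<in>I. a p * of_bool (p \<in> s \<omega>)) - b))"
  shows "(\<lambda>p\<in>I. \<Sum>\<omega>\<in>\<Omega>. \<mu> \<omega> * of_bool (p \<in> s \<omega>)) \<in> sherali_adams I C r"
proof -
  have \<Omega>: "finite \<Omega>"
    using total by (metis sum.infinite zero_neq_one)
  define y where "y = (\<lambda>A\<in>subsets_upto I (r + 1). \<Sum>\<omega>\<in>\<Omega>. \<mu> \<omega> * of_bool (A \<subseteq> s \<omega>))"
  have cond: "conditioned y Y N A =
      (\<Sum>\<omega> | \<omega> \<in> \<Omega> \<and> Y \<subseteq> s \<omega> \<and> N \<inter> s \<omega> = {}. \<mu> \<omega> * of_bool (A \<subseteq> s \<omega>))"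
    if YN: "Y \<union> N \<in> subsets_upto I r" and A: "A \<in> subsets_upto I 1" for Y N A
  proof -
    have N: "finite N"
      using YN I by (auto simp: subsets_upto_def intro: finite_subset)
    \<comment> \<open>The truncated \<open>y\<close> is the true moment on every set that occurs:
      \<open>A\<close> adds at most one element to a set of size at most \<open>r\<close>.\<close>
    have dom: "A \<union> (Y \<union> T) \<in> subsets_upto I (r + 1)" if "T \<subseteq> N" for T
    proof -
      have "finite (Y \<union> N)"
        using YN I by (auto simp: subsets_upto_def intro: finite_subset)
      then have "card (Y \<union> T) \<le> card (Y \<union> N)"
        using that by (intro card_mono) auto
      then show ?thesis
        using YN A that card_Un_le[of A "Y \<union> T"] by (auto simp: subsets_upto_def)
    qed
    have "conditioned y Y N A = (\<Sum>T\<in>Pow N. \<Sum>\<omega>\<in>\<Omega>.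
        (-1) ^ card T * (\<mu> \<omega> * of_bool (A \<union> (Y \<union> T) \<subseteq> s \<omega>)))"
      unfolding conditioned_def using dom by (simp add: y_def sum_distrib_left)
    \<comment> \<open>The indicator of a union being contained in \<open>s \<omega>\<close> factors,
      which isolates the signed sum over \<open>T\<close>.\<close>
    also have "\<dots> = (\<Sum>\<omega>\<in>\<Omega>. \<mu> \<omega> * of_bool (A \<subseteq> s \<omega>) * of_bool (Y \<subseteq> s \<omega>) *
        (\<Sum>T\<in>Pow N. (-1) ^ card T * of_bool (T \<subseteq> s \<omega>)))"
      unfolding sum_distrib_left by (subst sum.swap) (intro sum.cong refl, simp add: of_bool_conj)
    also have "\<dots> = (\<Sum>\<omega> | \<omega> \<in> \<Omega> \<and> Y \<subseteq> s \<omega> \<and> N \<inter> s \<omega> = {}. \<mu> \<omega> * of_bool (A \<subseteq> s \<omega>))"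
      unfolding sum_Pow_sign_subset[OF N] using \<Omega>
      by (intro sum.mono_neutral_cong_right) auto
    finally show ?thesis .
  qed
  have "y \<in> sa_lifts I C r"
    unfolding sa_lifts_def mem_Collect_eq
  proof (intro conjI allI impI)
    show "y \<in> subsets_upto I (r + 1) \<rightarrow>\<^sub>E UNIV" and "y {} = 1"
      by (auto simp: y_def total)
    fix Y N
    assume YN: "Y \<union> N \<in> subsets_upto I r"
    then show "0 \<le> conditioned y Y N {}"
      by (auto simp: cond intro!: sum_nonneg nonneg)
    fix a b
    assume ab: "(a, b) \<in> C"
    let ?\<Omega> = "{\<omega> \<in> \<Omega>. Y \<subseteq> s \<omega> \<and> N \<inter> s \<omega> = {}}"
    have "(\<Sum>p\<in>I. a p * conditioned y Y N {p}) =
        (\<Sum>p\<in>I. \<Sum>\<omega>\<in>?\<Omega>. a p * (\<mu> \<omega> * of_bool (p \<in> s \<omega>)))"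
      using YN by (simp add: cond sum_distrib_left)
    also have "\<dots> = (\<Sum>\<omega>\<in>?\<Omega>. \<mu> \<omega> * (\<Sum>p\<in>I. a p * of_bool (p \<in> s \<omega>)))"
      unfolding sum_distrib_left by (subst sum.swap) (simp add: ac_simps)
    finally have "(\<Sum>p\<in>I. a p * conditioned y Y N {p}) - b * conditioned y Y N {} =
        (\<Sum>\<omega>\<in>?\<Omega>. \<mu> \<omega> * ((\<Sum>p\<in>I. a p * of_bool (p \<in> s \<omega>)) - b))"
      using YN by (simp add: cond right_diff_distrib sum_subtractf sum_distrib_left ac_simps)
    then show "b * conditioned y Y N {} \<le> (\<Sum>p\<in>I. a p * conditioned y Y N {p})"
      using valid[OF YN ab] by simp
  qed
  moreover have "(\<lambda>p\<in>I. \<Sum>\<omega>\<in>\<Omega>. \<mu> \<omega> * of_bool (p \<in> s \<omega>)) = (\<lambda>p\<in>I. y {p})"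
    by (intro restrict_ext) (simp add: y_def)
  ultimately show ?thesis
    unfolding sherali_adams_eq_image by blast
qed

section \<open>Stars in a complete graph\<close>

text \<open>Supports of the integral points in the mixture; \<open>None\<close> stands for the zero
  vector.\<close>

definition star_state :: "'v ugraph \<Rightarrow> 'v option \<Rightarrow> ('v + 'v set) set" where
  "star_state G \<omega> = (case \<omega> of None \<Rightarrow> {} | Some v \<Rightarrow> insert (Inl v) (Inr ` {e \<in> edges G. v \<in> e}))"

lemma star_state_None [simp]: "star_state G None = {}"
  by (simp add: star_state_def)

lemma in_star_state_Some [simp]:
  "Inl u \<in> star_state G (Some v) \<longleftrightarrow> u = v"
  "Inr e \<in> star_state G (Some v) \<longleftrightarrow> e \<in> edges G \<and> v \<in> e"
  by (auto simp: star_state_def)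

lemma complete_graphD:
  assumes "complete_graph G"
  shows "simple_graph G" "finite (verts G)" "finite (edges G)"
    "edges G = {e. e \<subseteq> verts G \<and> card e = 2}"
  using assms simple_graph_finite[of G] by (simp_all add: complete_graph_def)

lemma complete_graph_degree:
  assumes G: "complete_graph G" and v: "v \<in> verts G"
  shows "card {e \<in> edges G. v \<in> e} = card (verts G) - 1"
proof -
  have "{e \<in> edges G. v \<in> e} = (\<lambda>u. {v, u}) ` (verts G - {v})"
    (is "?E = ?U")
  proof
    show "?E \<subseteq> ?U"
    proof
      fix e
      assume "e \<in> ?E"
      then obtain i j where "e = {i, j}" "i \<noteq> j" "{i, j} \<subseteq> verts G" "v \<in> {i, j}"
        by (auto simp: complete_graphD(4)[OF G] card_2_iff)
      then show "e \<in> ?U"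
        by (auto simp: doubleton_eq_iff)
    qed
    show "?U \<subseteq> ?E"
      using v by (auto simp: complete_graphD(4)[OF G])
  qed
  moreover have "inj_on (\<lambda>u. {v, u}) (verts G - {v})"
    by (auto simp: inj_on_def doubleton_eq_iff)
  ultimately show ?thesis
    using v complete_graphD(2)[OF G] by (simp add: card_image)
qed

lemma sum_pvc_ground:
  assumes "simple_graph G"
  shows "(\<Sum>p\<in>pvc_ground G. f p) = (\<Sum>v\<in>verts G. f (Inl v)) + (\<Sum>e\<in>edges G. f (Inr e))"
  using simple_graph_finite[OF assms] by (simp add: pvc_ground_def sum.Plus)

lemma finite_pvc_ground: "simple_graph G \<Longrightarrow> finite (pvc_ground G)"
  using simple_graph_finite[of G] by (simp add: pvc_ground_def)

text \<open>A vertex variable lies in one star only and an edge variable only in the stars of its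
  two endpoints, so \<open>N\<close> meets at most \<open>2 * r\<close> stars.\<close>

lemma card_untouched_vertices:
  assumes G: "simple_graph G" and N: "N \<subseteq> pvc_ground G" "card N \<le> r"
  shows "card (verts G) - 2 * r \<le> card {v \<in> verts G. N \<inter> star_state G (Some v) = {}}"
proof -
  have fin: "finite N" "finite (verts G)"
    using finite_subset[OF N(1) finite_pvc_ground[OF G]] simple_graph_finite[OF G] by auto
  \<comment> \<open>The candidates for vertices whose star contains \<open>q\<close>.\<close>
  define touch where "touch q = (case q of Inl u \<Rightarrow> {u} | Inr e \<Rightarrow> e)" for q :: "'a + 'a set"
  have touch: "finite (touch q) \<and> card (touch q) \<le> 2" if "q \<in> N" for q
  proof (cases q)
    case (Inr e)
    then have "card e = 2"
      using that N(1) G by (auto simp: pvc_ground_def simple_graph_def)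
    then show ?thesis
      using Inr by (simp add: touch_def card_ge_0_finite)
  qed (simp add: touch_def)
  have "card (\<Union>q\<in>N. touch q) \<le> (\<Sum>q\<in>N. card (touch q))"
    by (rule card_UN_le[OF fin(1)])
  also have "\<dots> \<le> (\<Sum>q\<in>N. 2)"
    by (intro sum_mono) (use touch in auto)
  finally have le: "card (\<Union>q\<in>N. touch q) \<le> 2 * r"
    using N(2) by simp
  have sub: "verts G - (\<Union>q\<in>N. touch q) \<subseteq> {v \<in> verts G. N \<inter> star_state G (Some v) = {}}"
    by (auto simp: star_state_def touch_def split: sum.splits)
  have "card (verts G) - card (\<Union>q\<in>N. touch q) \<le> card (verts G - (\<Union>q\<in>N. touch q))"
    using fin touch by (intro diff_card_le_card_Diff) auto
  also have "\<dots> \<le> card {v \<in> verts G. N \<inter> star_state G (Some v) = {}}"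
    using fin by (intro card_mono sub) auto
  finally show ?thesis
    using le by linarith
qed

text \<open>The alternatives in \<open>big\<close> are the two ways to meet the covering constraint:
  either the zero vector has weight 0, or the stars left after excluding any \<open>r\<close>
  variables supply edge weight \<open>t\<close>. By \<open>t < n\<close> each star meets the
  constraint by itself.\<close>

lemma star_mixture:
  fixes G :: "'v ugraph" and \<epsilon> :: real
  defines "n \<equiv> card (verts G)"
  assumes G: "complete_graph G" and \<epsilon>: "0 \<le> \<epsilon>" "n * \<epsilon> \<le> 1" and t: "t < n"
    and big: "n * \<epsilon> = 1 \<or> real t \<le> \<epsilon> * real (n - 2 * r) * real (n - 1)"
  obtains x where "x \<in> pvc_sherali_adams G t r" "fractional_cost G x = n * \<epsilon>"
proof -
  note SG = complete_graphD(1)[OF G] and fin = complete_graphD(2,3)[OF G]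
  define \<mu> where "\<mu> \<omega> = (case \<omega> of None \<Rightarrow> 1 - n * \<epsilon> | Some v \<Rightarrow> \<epsilon>)" for \<omega> :: "'v option"
  define \<Omega> where "\<Omega> = insert None (Some ` verts G)"
  let ?s = "star_state G"
  have sum_\<Omega>: "(\<Sum>\<omega> | \<omega> \<in> \<Omega> \<and> P \<omega>. \<mu> \<omega> * f \<omega>) =
      of_bool (P None) * (1 - n * \<epsilon>) * f None +
      \<epsilon> * (\<Sum>v | v \<in> verts G \<and> P (Some v). f (Some v))" for P and f :: "_ \<Rightarrow> real"
  proof -
    have "{\<omega> \<in> \<Omega>. P \<omega>} = (if P None then {None} else {}) \<union> Some ` {v \<in> verts G. P (Some v)}"
      by (auto simp: \<Omega>_def)
    then show ?thesis
      using fin by (simp add: \<mu>_def sum.reindex sum_distrib_left)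
  qed
  let ?x = "\<lambda>p\<in>pvc_ground G. \<Sum>\<omega>\<in>\<Omega>. \<mu> \<omega> * of_bool (p \<in> ?s \<omega>)"
  have "?x \<in> sherali_adams (pvc_ground G) (pvc_constraints G t) r"
  proof (rule mixture_in_sherali_adams[OF finite_pvc_ground[OF SG]])
    show \<mu>: "0 \<le> \<mu> \<omega>" for \<omega>
      using \<epsilon> by (simp add: \<mu>_def split: option.split)
    show "(\<Sum>\<omega>\<in>\<Omega>. \<mu> \<omega>) = 1"
      using sum_\<Omega>[where P = "\<lambda>_. True" and f = "\<lambda>_. 1"] by (simp add: n_def)
    fix Y N a b
    assume YN: "Y \<union> N \<in> subsets_upto (pvc_ground G) r" and C: "(a, b) \<in> pvc_constraints G t"
    let ?val = "\<lambda>\<omega>. \<Sum>p\<in>pvc_ground G. a p * of_bool (p \<in> ?s \<omega>)"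
    let ?S = "\<Sum>\<omega> | \<omega> \<in> \<Omega> \<and> Y \<subseteq> ?s \<omega> \<and> N \<inter> ?s \<omega> = {}. \<mu> \<omega> * (?val \<omega> - b)"
    \<comment> \<open>Settles every constraint except covering, since all the states satisfy
      those.\<close>
    have pointwise: "0 \<le> ?S" if "\<And>\<omega>. b \<le> ?val \<omega>"
      using that by (intro sum_nonneg mult_nonneg_nonneg \<mu>) simp
    have unit: "(\<Sum>p\<in>pvc_ground G. of_bool (p = q) * f p) = f q"
      if "q \<in> pvc_ground G" for q and f :: "_ \<Rightarrow> real"
      using that finite_pvc_ground[OF SG]
      by (simp add: of_bool_def if_distrib[of "\<lambda>c. c * _"] sum.delta cong: if_cong)
    consider
        (edge) e where "e \<in> edges G" "b = 0"
          "a = case_sum (\<lambda>v. of_bool (v \<in> e)) (\<lambda>f. - of_bool (f = e))"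
      | (cover) "a = case_sum (\<lambda>_. 0) (\<lambda>_. 1)" "b = real t"
      | (lower) q where "q \<in> pvc_ground G" "a = (\<lambda>p. of_bool (p = q))" "b = 0"
      | (upper) q where "q \<in> pvc_ground G" "a = (\<lambda>p. - of_bool (p = q))" "b = -1"
      using C unfolding pvc_constraints_def by blast
    then show "0 \<le> ?S"
    proof cases
      case (edge e)
      have "b \<le> ?val \<omega>" for \<omega>
      proof (cases \<omega>)
        case (Some v)
        have "(\<Sum>f\<in>edges G. - of_bool (f = e) * of_bool (v \<in> f)) = - of_bool (v \<in> e :: bool) * (1::real)"
          using edge(1) fin
          by (simp add: of_bool_def if_distrib[of "\<lambda>c. c * _"] sum.delta sum_negf cong: if_cong)
        moreover have "of_bool (v \<in> e) \<le> (\<Sum>u\<in>verts G. of_bool (u \<in> e) * of_bool (u = v) :: real)"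
        proof (cases "v \<in> e")
          case True
          then have "v \<in> verts G"
            using edge(1) SG by (auto simp: simple_graph_def)
          then show ?thesis
            using fin by (simp add: of_bool_def if_distrib[of "\<lambda>c. _ * c"] cong: if_cong)
        qed (simp add: sum_nonneg)
        ultimately show ?thesis
          using edge Some by (simp add: sum_pvc_ground[OF SG] cong: sum.cong)
      qed (simp add: edge)
      then show ?thesis
        by (rule pointwise)
    next
      case (lower q)
      show ?thesis
        by (rule pointwise) (use lower in \<open>simp add: unit\<close>)
    next
      case (upper q)
      show ?thesis
        by (rule pointwise) (use upper in \<open>simp add: unit sum_negf\<close>)
    next
      case cover
      have val: "?val (Some v) = real (n - 1)" if "v \<in> verts G" for v
      proof -
        have "?val (Some v) = (\<Sum>e\<in>edges G. of_bool (v \<in> e))"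
          by (simp add: cover sum_pvc_ground[OF SG] cong: sum.cong)
        also have "\<dots> = card {e \<in> edges G. v \<in> e}"
          using fin by (simp add: sum_of_bool_eq Int_def)
        finally show ?thesis
          using complete_graph_degree[OF G that] by (simp add: n_def)
      qed
      let ?W = "{v \<in> verts G. Y \<subseteq> ?s (Some v) \<and> N \<inter> ?s (Some v) = {}}"
      \<comment> \<open>The zero vector has deficit \<open>t\<close> and survives only for
        \<open>Y = {}\<close>; each surviving star has \<open>n - 1\<close> edges and hence surplus
        \<open>n - 1 - t\<close>.\<close>
      have S: "?S = - of_bool (Y = {}) * (1 - n * \<epsilon>) * t + \<epsilon> * card ?W * (real (n - 1) - t)"
      proof -
        have "(\<Sum>v\<in>?W. ?val (Some v) - b) = (\<Sum>v\<in>?W. real (n - 1) - t)"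
          by (intro sum.cong refl) (simp only: val cover(2) mem_Collect_eq)
        then show ?thesis
          unfolding sum_\<Omega> cover(2) by simp
      qed
      have W: "0 \<le> \<epsilon> * card ?W * (real (n - 1) - t)"
        using \<epsilon> t by simp
      show ?thesis
      proof (cases "Y = {} \<and> n * \<epsilon> \<noteq> 1")
        case True
        have "card N \<le> r" "N \<subseteq> pvc_ground G"
          using YN True by (auto simp: subsets_upto_def)
        then have k: "n - 2 * r \<le> card ?W"
          using card_untouched_vertices[OF SG, of N r] True by (simp add: n_def)
        \<comment> \<open>With \<open>w = card ?W <= n\<close>, the negative terms satisfy
          \<open>(1 - n * \<epsilon>) * t + \<epsilon> * w * t <= t\<close>, while the edge weight
          \<open>\<epsilon> * w * (n - 1)\<close> is at least \<open>t\<close>.\<close>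
        have "card ?W \<le> n"
          unfolding n_def using fin by (intro card_mono) auto
        then have "\<epsilon> * card ?W * t \<le> n * \<epsilon> * t"
          using \<epsilon> by (simp add: mult.commute mult_left_mono mult_right_mono)
        moreover have "real t \<le> \<epsilon> * card ?W * real (n - 1)"
        proof -
          have "real t \<le> \<epsilon> * real (n - 2 * r) * real (n - 1)"
            using big True by simp
          also have "\<dots> \<le> \<epsilon> * card ?W * real (n - 1)"
            using k \<epsilon> by (intro mult_right_mono mult_left_mono) auto
          finally show ?thesis .
        qed
        ultimately show ?thesis
          unfolding S using True by (simp add: algebra_simps)
      next
        case False
        then show ?thesis
          unfolding S using W by auto
      qed
    qed
  qed
  moreover have "fractional_cost G ?x = n * \<epsilon>"
  proof -
    have "?x (Inl v) = \<epsilon>" if "v \<in> verts G" for v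
      using that fin sum_\<Omega>[where P = "\<lambda>_. True" and f = "\<lambda>\<omega>. of_bool (Inl v \<in> ?s \<omega>)"]
      by (simp add: pvc_ground_def of_bool_def InlI)
    then show ?thesis
      by (simp add: fractional_cost_def n_def)
  qed
  ultimately show ?thesis
    using that by (simp add: pvc_sherali_adams_def)
qed

section \<open>Optimal values and the gap\<close>

text \<open>Zero cost makes all vertex variables 0, so no edge variable is positive and the edge sum
  cannot reach \<open>t\<close>. This keeps the denominator of the gap away from 0, where HOL
  division would return 0.\<close>

lemma fractional_cost_pos:
  assumes G: "simple_graph G" and x: "x \<in> pvc_polytope G t" and t: "t \<ge> 1"
  shows "0 < fractional_cost G x"
proof (rule ccontr)
  assume "\<not> 0 < fractional_cost G x"
  have P: "x \<in> pvc_ground G \<rightarrow>\<^sub>E {0..1}"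
    "\<And>i j. {i, j} \<in> edges G \<Longrightarrow> x (Inl i) + x (Inl j) \<ge> x (Inr {i, j})"
    "(\<Sum>e\<in>edges G. x (Inr e)) \<ge> real t"
    using x pvc_polytope_iff[OF G] by auto
  have nonneg: "0 \<le> x (Inl v)" if "v \<in> verts G" for v
    using P(1) that by (auto simp: pvc_ground_def PiE_iff)
  then have "0 \<le> fractional_cost G x"
    by (simp add: fractional_cost_def sum_nonneg)
  then have "fractional_cost G x = 0"
    using \<open>\<not> 0 < fractional_cost G x\<close> by simp
  then have zero: "x (Inl v) = 0" if "v \<in> verts G" for v
    using that nonneg simple_graph_finite[OF G]
    by (simp add: fractional_cost_def sum_nonneg_eq_0_iff)
  have "x (Inr e) \<le> 0" if e: "e \<in> edges G" for e
  proof -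
    obtain i j where "e = {i, j}" "i \<in> verts G" "j \<in> verts G"
      using e G by (auto simp: simple_graph_def card_2_iff)
    then show ?thesis
      using P(2)[of i j] e zero by simp
  qed
  then have "(\<Sum>e\<in>edges G. x (Inr e)) \<le> 0"
    by (rule sum_nonpos)
  then show False
    using P(3) t by simp
qed

text \<open>All vertices together cover every edge, so \<open>t <= card (edges G)\<close> ensures
  that the \<open>LEAST\<close> is attained; the empty set covers no edge.\<close>

lemma min_partial_vertex_cover_pos:
  assumes G: "simple_graph G" and t: "1 \<le> t" "t \<le> card (edges G)"
  shows "1 \<le> min_partial_vertex_cover G t"
proof -
  have "{e \<in> edges G. e \<inter> verts G \<noteq> {}} = edges G"
  proof -
    have "e \<inter> verts G \<noteq> {}" if "e \<in> edges G" for e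
    proof -
      have "e \<subseteq> verts G" "e \<noteq> {}"
        using G that by (auto simp: simple_graph_def)
      then show ?thesis
        by blast
    qed
    then show ?thesis
      by blast
  qed
  then have "partial_vertex_cover G t (verts G)"
    using t by (simp add: partial_vertex_cover_def)
  then have "\<exists>S. partial_vertex_cover G t S \<and> card S = min_partial_vertex_cover G t"
    unfolding min_partial_vertex_cover_def
    by (intro LeastI[where P = "\<lambda>k. \<exists>S. partial_vertex_cover G t S \<and> card S = k"]) blast
  then obtain S where S: "partial_vertex_cover G t S" "card S = min_partial_vertex_cover G t"
    by blast
  have "S \<noteq> {}"
    using S(1) t by (auto simp: partial_vertex_cover_def)
  moreover have "finite S"
    using S(1) simple_graph_finite[OF G] by (auto simp: partial_vertex_cover_def intro: finite_subset)
  ultimately have "0 < card S"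
    by (simp add: card_gt_0_iff)
  then show ?thesis
    using S(2) by simp
qed

text \<open>A continuous cost on a nonempty compact set attains its infimum, so the
  \<open>INF\<close> in \<open>integrality_gap\<close> is the optimal value of the
  relaxation.\<close>

lemma pvc_sherali_adams_minimiser:
  assumes G: "simple_graph G" and ne: "pvc_sherali_adams G t r \<noteq> {}"
  obtains x where "is_arg_min (fractional_cost G) (\<lambda>x. x \<in> pvc_sherali_adams G t r) x"
proof -
  have "compact (pvc_sherali_adams G t r)"
    unfolding pvc_sherali_adams_def
    by (rule compact_sherali_adams[OF finite_pvc_ground[OF G]]) (auto simp: pvc_constraints_def)
  moreover have "continuous_on (pvc_sherali_adams G t r) (fractional_cost G)"
    unfolding fractional_cost_def
    by (intro continuous_intros continuous_on_product_coordinates[THEN continuous_on_subset]) simp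
  ultimately show ?thesis
    using continuous_attains_inf[OF _ ne] that by (metis is_arg_min_linorder)
qed

text \<open>The conjuncts on \<open>card (edges G)\<close> and on \<open>is_arg_min\<close> certify
  that the \<open>LEAST\<close> and the \<open>INF\<close> in the gap are genuine minima.\<close>

theorem theorem1:
  fixes n r t :: nat
  assumes "r \<ge> 1" and "t \<ge> 1" and "n \<ge> 2 * r + 2 * t + 2"
  shows "\<exists>G :: nat ugraph. complete_graph G \<and> card (verts G) = n \<and> t \<le> card (edges G) \<and>
    (\<exists>x. is_arg_min (fractional_cost G) (\<lambda>x. x \<in> pvc_sherali_adams G t r) x) \<and>
    integrality_gap G t (pvc_sherali_adams G t r)
      \<ge> real ((n - 2 * r) choose 2) / (real t * real n)"
proof -
  define G :: "nat ugraph" where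
    "G = \<lparr>verts = {..<n}, edges = {e. e \<subseteq> {..<n} \<and> card e = 2}\<rparr>"
  have G: "complete_graph G" and n: "card (verts G) = n"
    by (auto simp: G_def complete_graph_def simple_graph_def)
  note SG = complete_graphD(1)[OF G]
  let ?R = "pvc_sherali_adams G t r"
  define c where "c = real ((n - 2 * r) choose 2)"
  define m where "m = n - 2 * r"
  have m: "2 * t + 2 \<le> m" "m \<le> n"
    using assms by (auto simp: m_def)
  have "2 * (m choose 2) = m * (m - 1)"
    using times_binomial_minus1_eq[of 2 m] by simp
  then have c: "2 * c = real m * real (m - 1)"
    unfolding c_def m_def[symmetric] by (metis of_nat_mult of_nat_numeral)
  have "0 < c"
    using m by (simp add: c_def m_def[symmetric] zero_less_binomial_iff)
  \<comment> \<open>A single star already has \<open>n - 1 >= t\<close> edges.\<close>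
  have t_edges: "t \<le> card (edges G)"
  proof -
    have "0 \<in> verts G"
      using assms by (simp add: G_def)
    then have "n - 1 = card {e \<in> edges G. 0 \<in> e}"
      using complete_graph_degree[OF G] n by simp
    also have "\<dots> \<le> card (edges G)"
      using complete_graphD(3)[OF G] by (intro card_mono) auto
    finally show ?thesis
      using assms by simp
  qed
  \<comment> \<open>The first bound keeps the weight of the zero vector nonnegative; the second
    makes the cost at most \<open>t * n / c\<close>.\<close>
  define \<epsilon> where "\<epsilon> = min (1 / n) (t / c)"
  have \<epsilon>: "0 \<le> \<epsilon>" "n * \<epsilon> \<le> 1" "n * \<epsilon> \<le> t * n / c"
    using \<open>0 < c\<close> assms by (auto simp: \<epsilon>_def min_def field_simps)
  have "n * \<epsilon> = 1 \<or> real t \<le> \<epsilon> * real m * real (n - 1)"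
  proof (cases "1 / n \<le> t / c")
    case True
    then show ?thesis
      using assms by (simp add: \<epsilon>_def)
  next
    case False
    have "c \<le> real m * real (m - 1)"
      using c \<open>0 < c\<close> by linarith
    also have "\<dots> \<le> real m * real (n - 1)"
      using m by (intro mult_left_mono) auto
    finally have "c \<le> real m * real (n - 1)" .
    then have "t / c * c \<le> t / c * (real m * real (n - 1))"
      by (rule mult_left_mono) (use \<open>0 < c\<close> in simp)
    then show ?thesis
      using False \<open>0 < c\<close> by (simp add: \<epsilon>_def mult.assoc)
  qed
  moreover have "t < n"
    using assms by simp
  ultimately obtain x where x: "x \<in> ?R" "fractional_cost G x = n * \<epsilon>"
    using star_mixture[OF G, of \<epsilon> t r, unfolded n] \<epsilon>(1,2) unfolding m_def by blast
  obtain z where z: "is_arg_min (fractional_cost G) (\<lambda>x. x \<in> ?R) z"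
    using pvc_sherali_adams_minimiser[OF SG, of t r] x(1) by blast
  then have zmin: "z \<in> ?R" "\<And>y. y \<in> ?R \<Longrightarrow> fractional_cost G z \<le> fractional_cost G y"
    by (auto simp: is_arg_min_linorder)
  have inf: "(INF x\<in>?R. fractional_cost G x) = fractional_cost G z"
    using zmin by (intro cInf_eq_minimum) auto
  have pos: "0 < fractional_cost G z"
    using sherali_adams_subset_polyhedron[OF zmin(1)[unfolded pvc_sherali_adams_def]]
    by (intro fractional_cost_pos[OF SG _ assms(2)]) (simp add: pvc_polytope_def)
  have le: "fractional_cost G z \<le> t * n / c"
    using zmin(2)[OF x(1)] x(2) \<epsilon>(3) by simp
  \<comment> \<open>The integral optimum is at least 1, so the gap is at least the reciprocal of the
    fractional optimum.\<close>
  have "c / (real t * real n) = 1 / (t * n / c)"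
    by simp
  also have "\<dots> \<le> 1 / fractional_cost G z"
    using le pos by (intro divide_left_mono mult_pos_pos) auto
  also have "\<dots> \<le> integrality_gap G t ?R"
    unfolding integrality_gap_def inf
    using min_partial_vertex_cover_pos[OF SG assms(2) t_edges] pos
    by (intro divide_right_mono) auto
  finally show ?thesis
    using G n t_edges z unfolding c_def by blast
qed

end
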